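(* Consider a distributed gradient tracking instance given by a consensus matrix $W$ and local curvatures $h_1,\dots,h_N>0$ as described in the context. Suppose that the essential spectral radius of $W$ satisfies $\sigma\in(0,1)$, that the curvature dispersion is $\eta=0$ (all $h_i$ equal), and that the eigenvalues of $W$ satisfy $\lambda_2\ge|\lambda_N|$. In this case the reduced system matrix is $$A_0(\beta)=\begin{bmatrix}1-\beta&0&0\\0&\Lambda&-\Lambda\\0&\beta(\Lambda-I)&(1-\beta)\Lambda\end{bmatrix},\qquad \Lambda=\operatorname{diag}(\lambda_2,\dots,\lambda_N).$$ Then the problem of minimizing the spectral radius $\rho(A_0(\beta))$ over $\beta>0$ has the unique solution $\beta^\star=1-\sqrt\sigma$, and $$\rho(A_0(\beta^\star))=R_0(\beta^\star,\sigma)=\sqrt\sigma.$$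
   Context: Setting. $\mathcal G=(\mathcal V,\mathcal E)$ is an undirected connected graph on $\mathcal V=\{1,\dots,N\}$ without self-loops. $W=[w_{ij}]\in\mathbb R^{N\times N}$ is symmetric and doubly stochastic, with $w_{ij}\in(0,1)$ if $(i,j)\in\mathcal E$ or $i=j$, and $w_{ij}=0$ otherwise. Its eigenvalues are $1=\lambda_1>\lambda_2\ge\cdots\ge\lambda_N>-1$, and its essential spectral radius is $\sigma:=\rho(W-\mathbf 1\mathbf 1^\top/N)=\max\{|\lambda_2|,|\lambda_N|\}<1$, where $\rho(\cdot)$ is the spectral radius. The curvature dispersion is $\eta:=\max_i|h_i-\bar h|/\bar h$ with $\bar h:=\frac1N\sum_i h_i$. The reduced system matrix $A(\beta)$ for general curvatures is $$A(\beta)=\begin{bmatrix}1-\beta & \beta\delta^\top(\Lambda-I) & -\beta\delta^\top\Lambda\\ 0&\Lambda&-\Lambda\\ -\beta\delta&\beta(I+\widetilde\Delta)(\Lambda-I)&(I-\beta(I+\widetilde\Delta))\Lambda\end{bmatrix},$$ where $\delta=U^\top\Delta v$, $\widetilde\Delta=U^\top\Delta U$, $\Delta=\operatorname{diag}(h_1/\bar h,\dots,h_N/\bar h)-I$, $v=\mathbf 1/\sqrt N$ and $U$ has as columns orthonormal eigenvectors of $W$ associated with $\lambda_2,\dots,\lambda_N$; when $\eta=0$ it equals $A_0(\beta)$. For $\beta>0$ the worst-case root radius is $$R_0(\beta,\sigma):=\max\Big\{|1-\beta|,\ \sup_{\lambda\in[-\sigma,\sigma]}\max\{|z|: z\in\mathbb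 C,\ P_\lambda(z;\beta)=0\}\Big\},\qquad P_\lambda(z;\beta):=(z-\lambda)^2+\beta\lambda(z-1).$$ *)

theory Defs
  imports
    "Jordan_Normal_Form.Spectral_Radius"
    "Graph_Theory.Graph_Theory"
begin

text \<open>
  Agents are numbered from \<open>0\<close> to \<open>N - 1\<close>, in accordance with the indexing of matrices and
  vectors. An undirected graph without self-loops is a symmetric loop-free digraph (locale
  \<^locale>\<open>pair_graph\<close>), each undirected edge being represented by its two arcs.
\<close>

definition connected_graph_on :: "nat \<Rightarrow> nat pair_pre_digraph \<Rightarrow> bool" where
  "connected_graph_on N G \<longleftrightarrow>
     pair_graph G \<and> pverts G = {..<N} \<and> Digraph_Component.connected (with_proj G)"

definition doubly_stochastic :: "nat \<Rightarrow> real mat \<Rightarrow> bool" where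
  "doubly_stochastic N W \<longleftrightarrow>
     (\<forall>i<N. \<forall>j<N. 0 \<le> W $$ (i, j)) \<and>
     (\<forall>i<N. (\<Sum>j<N. W $$ (i, j)) = 1) \<and>
     (\<forall>j<N. (\<Sum>i<N. W $$ (i, j)) = 1)"

definition consensus_matrix :: "nat \<Rightarrow> nat pair_pre_digraph \<Rightarrow> real mat \<Rightarrow> bool" where
  "consensus_matrix N G W \<longleftrightarrow>
     W \<in> carrier_mat N N \<and> transpose_mat W = W \<and> doubly_stochastic N W \<and>
     (\<forall>i<N. \<forall>j<N. if (i, j) \<in> parcs G \<or> i = j
        then 0 < W $$ (i, j) \<and> W $$ (i, j) < 1 else W $$ (i, j) = 0)"

text \<open>
  The list of all eigenvalues with multiplicity, in descending order. It is unique, and it exists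
  for every symmetric real matrix. The entry \<open>ls ! k\<close> is \<open>\<lambda>\<^sub>k\<^sub>+\<^sub>1\<close>; thus \<open>ls ! 1\<close> is \<open>\<lambda>\<^sub>2\<close>.
\<close>

definition eigenvalues_desc :: "real mat \<Rightarrow> real list \<Rightarrow> bool" where
  "eigenvalues_desc W ls \<longleftrightarrow>
     char_poly W = (\<Prod>a\<leftarrow>ls. [:- a, 1:]) \<and> sorted_wrt (\<ge>) ls"

text \<open>The spectral radius of a real matrix takes its complex eigenvalues into account.\<close>

definition rho :: "real mat \<Rightarrow> real" where
  "rho A = spectral_radius (map_mat complex_of_real A)"

definition ess_spectral_radius :: "nat \<Rightarrow> real mat \<Rightarrow> real" where
  "ess_spectral_radius N W = rho (W - mat N N (\<lambda>_. 1 / real N))"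

definition mean_curvature :: "nat \<Rightarrow> real vec \<Rightarrow> real" where
  "mean_curvature N h = (\<Sum>i<N. h $ i) / real N"

definition curvature_dispersion :: "nat \<Rightarrow> real vec \<Rightarrow> real" where
  "curvature_dispersion N h =
     Max ((\<lambda>i. \<bar>h $ i - mean_curvature N h\<bar>) ` {..<N}) / mean_curvature N h"

definition append_cols :: "'a :: zero mat \<Rightarrow> 'a mat \<Rightarrow> 'a mat" where
  "append_cols A B = four_block_mat A B (0\<^sub>m 0 (dim_col A)) (0\<^sub>m 0 (dim_col B))"

definition nine_block_mat ::
  "'a :: zero mat \<Rightarrow> 'a mat \<Rightarrow> 'a mat \<Rightarrow> 'a mat \<Rightarrow> 'a mat \<Rightarrow> 'a mat \<Rightarrow>
   'a mat \<Rightarrow> 'a mat \<Rightarrow> 'a mat \<Rightarrow> 'a mat" where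
  "nine_block_mat A11 A12 A13 A21 A22 A23 A31 A32 A33 =
     four_block_mat A11 (append_cols A12 A13)
       (A21 @\<^sub>r A31) (four_block_mat A22 A23 A32 A33)"

definition Lambda_mat :: "nat \<Rightarrow> real list \<Rightarrow> real mat" where
  "Lambda_mat N ls = mat_diag (N - 1) (\<lambda>k. ls ! Suc k)"

definition orthonormal_eigenbasis :: "nat \<Rightarrow> real mat \<Rightarrow> real list \<Rightarrow> real mat \<Rightarrow> bool" where
  "orthonormal_eigenbasis N W ls U \<longleftrightarrow>
     U \<in> carrier_mat N (N - 1) \<and> transpose_mat U * U = 1\<^sub>m (N - 1) \<and>
     (\<forall>k<N - 1. eigenvector W (col U k) (ls ! Suc k))"

text \<open>The vectors \<open>v\<close> and \<open>\<delta>\<close> are represented as matrices with one column.\<close>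

definition reduced_system_matrix ::
  "nat \<Rightarrow> real list \<Rightarrow> real vec \<Rightarrow> real mat \<Rightarrow> real \<Rightarrow> real mat" where
  "reduced_system_matrix N ls h U \<beta> =
     (let m = N - 1;
          I = 1\<^sub>m m;
          L = Lambda_mat N ls;
          v = mat N 1 (\<lambda>_. 1 / sqrt (real N));
          \<Delta> = mat_diag N (\<lambda>i. h $ i / mean_curvature N h) - 1\<^sub>m N;
          \<delta> = transpose_mat U * \<Delta> * v;
          \<Delta>' = transpose_mat U * \<Delta> * U
      in nine_block_mat
           (mat 1 1 (\<lambda>_. 1 - \<beta>)) (\<beta> \<cdot>\<^sub>m (transpose_mat \<delta> * (L - I))) (- (\<beta> \<cdot>\<^sub>m (transpose_mat \<delta> * L)))
           (0\<^sub>m m 1)              L                                  (- L)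
           (- (\<beta> \<cdot>\<^sub>m \<delta>))         (\<beta> \<cdot>\<^sub>m ((I + \<Delta>') * (L - I)))         ((I - \<beta> \<cdot>\<^sub>m (I + \<Delta>')) * L))"

definition reduced_system_matrix_0 :: "nat \<Rightarrow> real list \<Rightarrow> real \<Rightarrow> real mat" where
  "reduced_system_matrix_0 N ls \<beta> =
     (let m = N - 1;
          I = 1\<^sub>m m;
          L = Lambda_mat N ls
      in nine_block_mat
           (mat 1 1 (\<lambda>_. 1 - \<beta>)) (0\<^sub>m 1 m)        (0\<^sub>m 1 m)
           (0\<^sub>m m 1)              L               (- L)
           (0\<^sub>m m 1)              (\<beta> \<cdot>\<^sub>m (L - I))   ((1 - \<beta>) \<cdot>\<^sub>m L))"

definition P_quad :: "real \<Rightarrow> real \<Rightarrow> complex \<Rightarrow> complex" where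
  "P_quad l \<beta> z =
     (z - complex_of_real l)\<^sup>2 + complex_of_real \<beta> * complex_of_real l * (z - 1)"

definition R0 :: "real \<Rightarrow> real \<Rightarrow> real" where
  "R0 \<beta> \<sigma> = max \<bar>1 - \<beta>\<bar> (SUP l\<in>{-\<sigma>..\<sigma>}. Max (cmod ` {z. P_quad l \<beta> z = 0}))"

end

theory Submission
  imports Defs
begin

text \<open>
  Since \<open>W\<close> has unit column sums, replacing \<open>W\<close> by \<open>W - 1 1\<^sup>T / N\<close> exchanges the factor \<open>x - 1\<close> of
  the characteristic polynomial for \<open>x\<close>; with the dominance assumption this gives
  \<open>\<sigma> = \<lambda>\<^sub>2\<close>. The characteristic polynomial of \<open>A\<^sub>0(\<beta>)\<close> is
  \<open>(x - (1 - \<beta>)) * (\<Prod>k\<ge>2. P\<^bsub>\<lambda>\<^sub>k\<^esub>(x; \<beta>))\<close>. Put \<open>s = sqrt \<sigma>\<close>. For \<open>\<beta> = 1 - s\<close> and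
  \<open>\<bar>\<lambda>\<bar> \<le> s\<^sup>2\<close> the Schur stability criterion confines the roots of \<open>P\<^sub>\<lambda>\<close> to the disc of radius
  \<open>s\<close>. If \<open>\<beta> < 1 - s\<close>, the eigenvalue \<open>1 - \<beta>\<close> exceeds \<open>s\<close>; if \<open>\<beta> > 1 - s\<close>, then
  \<open>P\<^sub>\<sigma>(s; \<beta>) = s\<^sup>2 (1 - s) (1 - s - \<beta>) < 0\<close>, so \<open>P\<^sub>\<sigma>\<close> has a real root beyond \<open>s\<close>.
\<close>

section \<open>Shifting a matrix with constant column sums by the averaging matrix\<close>

text \<open>
  Adding all rows to the first one turns it into a multiple of the all-ones row, which
  then absorbs the constant \<open>c\<close> in all other rows.
\<close>

lemma det_add_const_mat:
  fixes M :: "'a :: comm_ring_1 mat"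
  assumes M: "M \<in> carrier_mat n n" and n: "0 < n"
    and sums: "\<And>j. j < n \<Longrightarrow> (\<Sum>i<n. M $$ (i, j)) = r"
  obtains d where "det M = r * d" and "det (M + mat n n (\<lambda>_. c)) = (r + of_nat n * c) * d"
proof -
  \<comment> \<open>\<open>E\<close> adds all rows to the first, \<open>F\<close> adds
    \<open>c\<close> times the first row to every other row, and \<open>D s\<close> scales the first
    row by \<open>s\<close>. \<open>R\<close> is \<open>M\<close> with its first row replaced by
    ones; its determinant is the common factor \<open>d\<close>.\<close>
  define E :: "'a mat" where "E = mat n n (\<lambda>(i, j). if i = 0 \<or> i = j then 1 else 0)"
  define F :: "'a mat" where
    "F = mat n n (\<lambda>(i, j). if i = j then 1 else if j = 0 then c else 0)"
  define R where "R = mat n n (\<lambda>(i, j). if i = 0 then 1 else M $$ (i, j))"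
  define D :: "'a \<Rightarrow> 'a mat" where "D = (\<lambda>s. mat_diag n (\<lambda>i. if i = 0 then s else 1))"
  have carr: "E \<in> carrier_mat n n" "F \<in> carrier_mat n n" "R \<in> carrier_mat n n"
    "\<And>s. D s \<in> carrier_mat n n"
    by (auto simp: E_def F_def R_def D_def)
  have "det E = prod_list (diag_mat E)"
    by (rule det_upper_triangular[of _ n]) (auto simp: E_def intro!: upper_triangularI)
  then have detE: "det E = 1"
    by (simp add: prod_list_diag_prod E_def)
  have "det F = prod_list (diag_mat F)"
    by (rule det_lower_triangular[of n]) (auto simp: F_def)
  then have detF: "det F = 1"
    by (simp add: prod_list_diag_prod F_def)
  have detD: "det (D s) = s" for s
  proof -
    have "det (D s) = prod_list (diag_mat (D s))"
      by (rule det_upper_triangular[of _ n]) (auto simp: D_def mat_diag_def intro!: upper_triangularI)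
    also have "\<dots> = (\<Prod>i = 0..<n. if i = 0 then s else 1)"
      by (simp add: prod_list_diag_prod D_def mat_diag_def)
    also have "\<dots> = s" using n by (simp add: prod.delta)
    finally show ?thesis .
  qed
  have E_mult: "E * X = mat n n (\<lambda>(i, j). if i = 0 then \<Sum>k<n. X $$ (k, j) else X $$ (i, j))"
    if X: "X \<in> carrier_mat n n" for X
  proof (rule eq_matI)
    fix i j assume "i < dim_row (mat n n (\<lambda>(i, j). if i = 0 then \<Sum>k<n. X $$ (k, j) else X $$ (i, j)))"
      and "j < dim_col (mat n n (\<lambda>(i, j). if i = 0 then \<Sum>k<n. X $$ (k, j) else X $$ (i, j)))"
    then have ij: "i < n" "j < n" by auto
    have "(E * X) $$ (i, j) = (\<Sum>k = 0..<n. (if i = 0 \<or> i = k then 1 else 0) * X $$ (k, j))"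
      using ij X by (simp add: E_def scalar_prod_def)
    also have "\<dots> = (if i = 0 then \<Sum>k<n. X $$ (k, j) else X $$ (i, j))"
      using ij by (auto simp: lessThan_atLeast0 if_distrib[of "\<lambda>x. x * _"] cong: if_cong)
    finally show "(E * X) $$ (i, j)
        = mat n n (\<lambda>(i, j). if i = 0 then \<Sum>k<n. X $$ (k, j) else X $$ (i, j)) $$ (i, j)"
      using ij by simp
  qed (use X in \<open>auto simp: E_def\<close>)
  have EM: "E * M = D r * R"
    unfolding E_mult[OF M] D_def mat_diag_mult_left[OF carr(3)]
    by (rule eq_matI) (auto simp: R_def sums)
  have FR: "F * R = mat n n (\<lambda>(i, j). if i = 0 then 1 else M $$ (i, j) + c)"
  proof (rule eq_matI)
    fix i j assume "i < dim_row (mat n n (\<lambda>(i, j). if i = 0 then 1 else M $$ (i, j) + c))"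
      and "j < dim_col (mat n n (\<lambda>(i, j). if i = 0 then 1 else M $$ (i, j) + c))"
    then have ij: "i < n" "j < n" by auto
    have "(F * R) $$ (i, j) = (\<Sum>k = 0..<n. F $$ (i, k) * R $$ (k, j))"
      using ij carr by (simp add: scalar_prod_def)
    also have "\<dots> = (\<Sum>k\<in>{0, i}. F $$ (i, k) * R $$ (k, j))"
      using ij by (intro sum.mono_neutral_right) (auto simp: F_def)
    also have "\<dots> = (if i = 0 then 1 else M $$ (i, j) + c)"
      using ij by (auto simp: F_def R_def)
    finally show "(F * R) $$ (i, j) = mat n n (\<lambda>(i, j). if i = 0 then 1 else M $$ (i, j) + c) $$ (i, j)"
      using ij by simp
  qed (use carr in auto)
  have EMc: "E * (M + mat n n (\<lambda>_. c)) = D (r + of_nat n * c) * (F * R)"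
  proof -
    have "E * (M + mat n n (\<lambda>_. c)) =
      mat n n (\<lambda>(i, j). if i = 0 then \<Sum>k<n. (M + mat n n (\<lambda>_. c)) $$ (k, j)
        else (M + mat n n (\<lambda>_. c)) $$ (i, j))"
      by (rule E_mult) (use M in auto)
    also have "\<dots> = D (r + of_nat n * c) * (F * R)"
      unfolding D_def FR
      by (subst mat_diag_mult_left[of _ n n], simp, rule eq_matI)
        (use M in \<open>auto simp: sums sum.distrib\<close>)
    finally show ?thesis .
  qed
  show thesis
  proof (rule that)
    show "det M = r * det R"
      using arg_cong[OF EM, of det] carr M by (simp add: det_mult[of _ n] detE detD)
    show "det (M + mat n n (\<lambda>_. c)) = (r + of_nat n * c) * det R"
      using arg_cong[OF EMc, of det] carr M by (simp add: det_mult[of _ n] detE detD detF)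
  qed
qed

text \<open>The columns of x I - W sum to x - 1, and subtracting the averaging matrix from W adds
  1/n to each entry of x I - W, so the column sums become x. The shared cofactor \<open>d\<close>
  carries the remaining eigenvalues.\<close>

lemma char_poly_sub_averaging:
  fixes W :: "real mat"
  assumes W: "W \<in> carrier_mat n n" and n: "0 < n"
    and sums: "\<And>j. j < n \<Longrightarrow> (\<Sum>i<n. W $$ (i, j)) = 1"
  obtains d where "char_poly W = [:-1, 1:] * d"
    and "char_poly (W - mat n n (\<lambda>_. 1 / real n)) = [:0, 1:] * d"
proof -
  have col: "(\<Sum>i<n. char_poly_matrix W $$ (i, j)) = [:-1, 1:]" if j: "j < n" for j
  proof -
    have "(\<Sum>i<n. char_poly_matrix W $$ (i, j)) = (\<Sum>i<n. (if i = j then [:0, 1:] else 0) + [:- W $$ (i, j):])"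
      using W j by (intro sum.cong) (auto simp: char_poly_matrix_def)
    also have "\<dots> = [:0, 1:] + [:- (\<Sum>i<n. W $$ (i, j)):]"
    proof -
      have "(\<Sum>i<n. [:- W $$ (i, j):]) = [:\<Sum>i<n. - W $$ (i, j):]"
        by (induction n) auto
      then show ?thesis using j by (simp add: sum.distrib sum_negf)
    qed
    finally show ?thesis using sums[OF j] by simp
  qed
  obtain d where d: "det (char_poly_matrix W) = [:-1, 1:] * d"
    "det (char_poly_matrix W + mat n n (\<lambda>_. [:1 / real n:])) = ([:-1, 1:] + of_nat n * [:1 / real n:]) * d"
    using det_add_const_mat[OF char_poly_matrix_closed[OF W] n col] by metis
  have eq: "char_poly_matrix (W - mat n n (\<lambda>_. 1 / real n))
      = char_poly_matrix W + mat n n (\<lambda>_. [:1 / real n:])"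
    using W by (intro eq_matI) (auto simp: char_poly_matrix_def)
  have "[:-1, 1:] + of_nat n * [:1 / real n:] = [:0, 1:]"
    using n by (simp add: of_nat_poly)
  then show thesis
    using that[of d] d by (simp only: char_poly_def eq)
qed

section \<open>Eigenvalues of stochastic matrices and the spectral radius\<close>

text \<open>In the row of an eigenvector entry of largest modulus, the eigenvalue equation bounds
  \<bar>l\<bar> times that modulus by a convex combination of moduli that are no larger.\<close>

lemma stochastic_eigenvalue_le_1:
  fixes W :: "real mat"
  assumes W: "W \<in> carrier_mat n n" and nonneg: "\<And>i j. i < n \<Longrightarrow> j < n \<Longrightarrow> 0 \<le> W $$ (i, j)"
    and sums: "\<And>i. i < n \<Longrightarrow> (\<Sum>j<n. W $$ (i, j)) = 1"
    and ev: "eigenvalue W l"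
  shows "l \<le> 1"
proof -
  obtain v where v: "v \<in> carrier_vec n" "v \<noteq> 0\<^sub>v n" "W *\<^sub>v v = l \<cdot>\<^sub>v v"
    using ev W unfolding eigenvalue_def eigenvector_def by auto
  obtain k where k: "k < n" "v $ k \<noteq> 0"
    using v(1,2) by (metis carrier_vecD eq_vecI index_zero_vec)
  have fin: "finite ((\<lambda>i. \<bar>v $ i\<bar>) ` {..<n})" "(\<lambda>i. \<bar>v $ i\<bar>) ` {..<n} \<noteq> {}" using k by auto
  obtain i where i: "i < n" "\<bar>v $ i\<bar> = Max ((\<lambda>i. \<bar>v $ i\<bar>) ` {..<n})"
    using Max_in[OF fin] by auto
  have max: "\<bar>v $ j\<bar> \<le> \<bar>v $ i\<bar>" if "j < n" for j
    unfolding i(2) using that by (intro Max_ge) auto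
  have "l * v $ i = (\<Sum>j<n. W $$ (i, j) * v $ j)"
    using arg_cong[OF v(3), of "\<lambda>x. x $ i"] v(1) W i(1) by (simp add: scalar_prod_def lessThan_atLeast0)
  then have "\<bar>l * v $ i\<bar> \<le> (\<Sum>j<n. \<bar>W $$ (i, j) * v $ j\<bar>)"
    by (simp only: sum_abs)
  also have "\<dots> \<le> (\<Sum>j<n. W $$ (i, j) * \<bar>v $ i\<bar>)"
    using nonneg i(1) max by (intro sum_mono) (auto simp: abs_mult intro!: mult_left_mono)
  also have "\<dots> = \<bar>v $ i\<bar>"
    using sums[OF i(1)] by (simp flip: sum_distrib_right)
  finally have "\<bar>l\<bar> * \<bar>v $ i\<bar> \<le> 1 * \<bar>v $ i\<bar>" by (simp add: abs_mult)
  moreover have "0 < \<bar>v $ i\<bar>" using max[OF k(1)] k(2) by auto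
  ultimately show ?thesis by (simp only: mult_le_cancel_right_pos)
qed

lemma rho_char_poly:
  assumes A: "A \<in> carrier_mat n n" and n: "0 < n"
  shows "poly (map_poly complex_of_real (char_poly A)) z = 0 \<Longrightarrow> cmod z \<le> rho A"
    and "\<exists>z. poly (map_poly complex_of_real (char_poly A)) z = 0 \<and> rho A = cmod z"
proof -
  have C: "map_mat complex_of_real A \<in> carrier_mat n n" using A by simp
  have spec: "spectrum (map_mat complex_of_real A) = {z. poly (map_poly complex_of_real (char_poly A)) z = 0}"
    unfolding spectrum_root_char_poly[OF C] of_real_hom.char_poly_hom[OF A] ..
  show "poly (map_poly complex_of_real (char_poly A)) z = 0 \<Longrightarrow> cmod z \<le> rho A"
    unfolding rho_def by (rule spectral_radius_mem_max(2)[OF C n]) (auto simp: spec)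
  show "\<exists>z. poly (map_poly complex_of_real (char_poly A)) z = 0 \<and> rho A = cmod z"
    using spectral_radius_mem_max(1)[OF C n] by (auto simp: spec rho_def)
qed

section \<open>The characteristic polynomial of \<open>A\<^sub>0(\<beta>)\<close>\<close>

text \<open>Diagonal blocks commute, so the determinant of the block matrix is that of the diagonal
  matrix AD - BC, and the modes decouple.\<close>

lemma char_poly_four_diag_blocks:
  fixes a b c d :: "nat \<Rightarrow> 'a :: idom"
  shows "char_poly (four_block_mat (mat_diag m a) (mat_diag m b) (mat_diag m c) (mat_diag m d))
    = (\<Prod>k<m. [:- a k, 1:] * [:- d k, 1:] - [:b k * c k:])"
proof -
  have "char_poly_matrix (four_block_mat (mat_diag m a) (mat_diag m b) (mat_diag m c) (mat_diag m d))
    = four_block_mat (mat_diag m (\<lambda>k. [:- a k, 1:])) (mat_diag m (\<lambda>k. [:- b k:]))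
        (mat_diag m (\<lambda>k. [:- c k:])) (mat_diag m (\<lambda>k. [:- d k, 1:]))"
    by (rule eq_matI) (auto simp: char_poly_matrix_def mat_diag_def)
  moreover have "det (four_block_mat (mat_diag m (\<lambda>k. [:- a k, 1:])) (mat_diag m (\<lambda>k. [:- b k:]))
        (mat_diag m (\<lambda>k. [:- c k:])) (mat_diag m (\<lambda>k. [:- d k, 1:])))
      = det (mat_diag m (\<lambda>k. [:- a k, 1:]) * mat_diag m (\<lambda>k. [:- d k, 1:])
          - mat_diag m (\<lambda>k. [:- b k:]) * mat_diag m (\<lambda>k. [:- c k:]))"
    by (rule det_four_block_mat[of _ m]) (simp_all only: mat_diag_dim mat_diag_diag mult.commute)
  moreover have "mat_diag m (\<lambda>k. [:- a k, 1:]) * mat_diag m (\<lambda>k. [:- d k, 1:])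
          - mat_diag m (\<lambda>k. [:- b k:]) * mat_diag m (\<lambda>k. [:- c k:])
      = mat_diag m (\<lambda>k. [:- a k, 1:] * [:- d k, 1:] - [:b k * c k:])"
    unfolding mat_diag_diag by (rule eq_matI) (auto simp: mat_diag_def)
  moreover have "det (mat_diag m f) = (\<Prod>k<m. f k)" for f :: "nat \<Rightarrow> 'a poly"
    by (subst det_upper_triangular[of _ m])
      (auto simp: mat_diag_def prod_list_diag_prod lessThan_atLeast0 intro!: upper_triangularI)
  ultimately show ?thesis
    unfolding char_poly_def by simp
qed

lemma reduced_system_matrix_0_block_diag:
  fixes ls :: "real list"
  defines "l \<equiv> \<lambda>k. ls ! Suc k"
  shows "reduced_system_matrix_0 N ls \<beta> =
    four_block_mat (mat 1 1 (\<lambda>_. 1 - \<beta>)) (0\<^sub>m 1 ((N - 1) + (N - 1))) (0\<^sub>m ((N - 1) + (N - 1)) 1)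
      (four_block_mat (mat_diag (N - 1) l) (mat_diag (N - 1) (\<lambda>k. - l k))
        (mat_diag (N - 1) (\<lambda>k. \<beta> * (l k - 1))) (mat_diag (N - 1) (\<lambda>k. (1 - \<beta>) * l k)))"
  unfolding reduced_system_matrix_0_def nine_block_mat_def append_cols_def append_rows_def Let_def
    Lambda_mat_def l_def
  by (intro cong_four_block_mat refl eq_matI) (auto simp: mat_diag_def)

lemma reduced_system_matrix_0_carrier:
  "reduced_system_matrix_0 N ls \<beta> \<in> carrier_mat (1 + ((N - 1) + (N - 1))) (1 + ((N - 1) + (N - 1)))"
  unfolding reduced_system_matrix_0_block_diag by (intro four_block_carrier_mat) auto

text \<open>The factor of a mode l is (x - l)(x - (1 - \<beta>) l) + \<beta> l (l - 1), which
  expands to the polynomial P of that mode.\<close>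

lemma char_poly_reduced_system_matrix_0:
  "char_poly (reduced_system_matrix_0 N ls \<beta>) = [:- (1 - \<beta>), 1:] *
     (\<Prod>k<N - 1. [:(ls ! Suc k)\<^sup>2 - \<beta> * ls ! Suc k, - (2 - \<beta>) * ls ! Suc k, 1:])"
proof -
  have "char_poly (mat 1 1 (\<lambda>_. 1 - \<beta>)) = [:- (1 - \<beta>), 1:]"
    by (simp add: char_poly_def char_poly_matrix_def det_single)
  then show ?thesis
    unfolding reduced_system_matrix_0_block_diag
    by (subst char_poly_four_block_zeros_col)
      (auto simp: char_poly_four_diag_blocks power2_eq_square algebra_simps intro!: four_block_carrier_mat)
qed

lemma char_poly_reduced_system_matrix_0_root_iff:
  "poly (map_poly complex_of_real (char_poly (reduced_system_matrix_0 N ls \<beta>))) z = 0 \<longleftrightarrow>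
     z = complex_of_real (1 - \<beta>) \<or> (\<exists>k<N - 1. P_quad (ls ! Suc k) \<beta> z = 0)"
proof -
  have "poly (map_poly complex_of_real [:l\<^sup>2 - \<beta> * l, - (2 - \<beta>) * l, 1:]) z = P_quad l \<beta> z" for l
    by (simp add: P_quad_def power2_eq_square algebra_simps)
  moreover interpret map_poly_hom: map_poly_comm_ring_hom complex_of_real ..
  have "poly (map_poly complex_of_real [:- (1 - \<beta>), 1:]) z = z - complex_of_real (1 - \<beta>)"
    by simp
  ultimately show ?thesis
    unfolding char_poly_reduced_system_matrix_0 map_poly_hom.hom_mult map_poly_hom.hom_prod
      poly_mult poly_prod mult_eq_0_iff
    by (simp only: prod_zero_iff finite_lessThan eq_iff_diff_eq_0[symmetric] bex_simps lessThan_iff Bex_def)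
qed

section \<open>Location of the roots of \<open>P\<^sub>\<lambda>\<close>\<close>

text \<open>Schur criterion for the disc of radius r. A non-real root has its conjugate as partner,
  so its squared modulus is the product c; a real root is treated by contradiction.\<close>

lemma quadratic_root_bound:
  fixes b c r :: real and z :: complex
  assumes root: "z\<^sup>2 - complex_of_real b * z + complex_of_real c = 0"
    and r: "0 < r" and c: "\<bar>c\<bar> \<le> r\<^sup>2" and b: "\<bar>b\<bar> * r \<le> r\<^sup>2 + c"
  shows "cmod z \<le> r"
proof (cases "Im z = 0")
  case True
  define x where "x = Re z"
  have z: "z = complex_of_real x" using True by (simp add: x_def complex_eq_iff)
  have x: "x\<^sup>2 - b * x + c = 0"
    using arg_cong[OF root, of Re] by (simp add: z power2_eq_square)
  have "\<bar>x\<bar> \<le> r"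
  proof (rule ccontr)
    assume "\<not> \<bar>x\<bar> \<le> r"
    then have xr: "r < \<bar>x\<bar>" by simp
    \<comment> \<open>If \<bar>x\<bar> > r, both factors on the left are positive, since c \<le> r^2
      < r \<bar>x\<bar>. The root equation and the bound on b make the right side
      nonpositive.\<close>
    have "(\<bar>x\<bar> - r) * (r * \<bar>x\<bar> - c) = r * (x\<^sup>2 + c) - \<bar>x\<bar> * (r\<^sup>2 + c)"
      by (simp add: algebra_simps power2_eq_square)
    also have "\<dots> \<le> 0"
    proof -
      have "x\<^sup>2 + c \<le> \<bar>b\<bar> * \<bar>x\<bar>" using x abs_ge_self[of "b * x"] by (simp add: abs_mult)
      then have "r * (x\<^sup>2 + c) \<le> r * (\<bar>b\<bar> * \<bar>x\<bar>)" using r by simp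
      also have "\<dots> \<le> \<bar>x\<bar> * (r\<^sup>2 + c)"
        using mult_left_mono[OF b, of "\<bar>x\<bar>"] by (simp add: algebra_simps)
      finally show ?thesis by simp
    qed
    finally have "(\<bar>x\<bar> - r) * (r * \<bar>x\<bar> - c) \<le> 0" .
    moreover have "r * r < r * \<bar>x\<bar>" using xr r by simp
    then have "c < r * \<bar>x\<bar>" using c by (simp add: power2_eq_square abs_le_iff)
    ultimately show False using xr by (smt (verit) mult_pos_pos)
  qed
  then show ?thesis by (simp add: z)
next
  case False
  have "Im z * (2 * Re z - b) = 0"
    using arg_cong[OF root, of Im] by (simp add: power2_eq_square algebra_simps)
  then have b': "b = 2 * Re z" using False by simp
  have "c = (Re z)\<^sup>2 + (Im z)\<^sup>2"
    using arg_cong[OF root, of Re] by (simp add: b' power2_eq_square algebra_simps)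
  then have "(cmod z)\<^sup>2 = c" by (simp only: cmod_power2)
  then have "(cmod z)\<^sup>2 \<le> r\<^sup>2" using c by simp
  then show ?thesis using r by (simp add: power2_le_iff_abs_le)
qed

lemma P_quad_root_bound:
  fixes s l :: real
  assumes s: "0 < s" "s < 1" and l: "\<bar>l\<bar> \<le> s\<^sup>2" and root: "P_quad l (1 - s) z = 0"
  shows "cmod z \<le> s"
proof (rule quadratic_root_bound)
  \<comment> \<open>The coefficient 1 + s is 2 - \<beta> at \<beta> = 1 - s.\<close>
  show "z\<^sup>2 - complex_of_real ((1 + s) * l) * z + complex_of_real (l\<^sup>2 - (1 - s) * l) = 0"
    using root by (simp add: P_quad_def power2_eq_square algebra_simps)
  have ss: "s\<^sup>2 < s" using s by (simp add: power2_eq_square)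
  show "\<bar>l\<^sup>2 - (1 - s) * l\<bar> \<le> s\<^sup>2"
  proof -
    have "\<bar>l\<^sup>2 - (1 - s) * l\<bar> = \<bar>l\<bar> * \<bar>l - (1 - s)\<bar>"
      by (simp add: power2_eq_square algebra_simps flip: abs_mult)
    \<comment> \<open>The second factor is at most 1 - s + s^2, which is below 1 because s^2 <
      s.\<close>
    also have "\<dots> \<le> s\<^sup>2 * 1"
      using l ss s by (intro mult_mono) auto
    finally show ?thesis by simp
  qed
  show "\<bar>(1 + s) * l\<bar> * s \<le> s\<^sup>2 + (l\<^sup>2 - (1 - s) * l)"
  proof (cases "0 \<le> l")
    case True
    \<comment> \<open>This product is exactly the slack of the claimed inequality. It vanishes at l
      = s^2, where the bound is tight.\<close>
    have "0 \<le> (1 - l) * (s\<^sup>2 - l)" using l ss s by (intro mult_nonneg_nonneg) auto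
    moreover have "\<bar>(1 + s) * l\<bar> = (1 + s) * l" using True s by simp
    ultimately show ?thesis by (simp only: power2_eq_square) (simp add: algebra_simps)
  next
    case False
    \<comment> \<open>For negative l the slack is this sum instead.\<close>
    have "0 \<le> (l + s)\<^sup>2 + (- l) * (1 - s\<^sup>2)" 
      using False ss s by (intro add_nonneg_nonneg mult_nonneg_nonneg) auto
    moreover have "\<bar>(1 + s) * l\<bar> = (1 + s) * (- l)" using False s by (simp add: abs_mult)
    ultimately show ?thesis by (simp only: power2_eq_square) (simp add: algebra_simps)
  qed
qed (use s in simp)

text \<open>\<open>R0\<close> applies \<open>Max\<close> to the moduli of the roots, which is a
  genuine maximum only for a finite nonempty set.\<close>

lemma P_quad_roots:
  shows "finite {z. P_quad l \<beta> z = 0}" and "{z. P_quad l \<beta> z = 0} \<noteq> {}"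
proof -
  define p where "p = [:complex_of_real (l\<^sup>2 - \<beta> * l), complex_of_real (- (2 - \<beta>) * l), 1:]"
  have p: "poly p z = P_quad l \<beta> z" for z
    by (simp add: p_def P_quad_def power2_eq_square algebra_simps)
  show "finite {z. P_quad l \<beta> z = 0}"
    using poly_roots_finite[of p] by (simp add: p) (simp add: p_def)
  have "\<not> constant (poly p)"
    by (simp add: constant_degree p_def)
  from fundamental_theorem_of_algebra[OF this]
  show "{z. P_quad l \<beta> z = 0} \<noteq> {}" by (simp add: p)
qed

text \<open>At \<beta> = 1 - s the term \<bar>1 - \<beta>\<bar> already equals s, so an upper bound
  s for the supremum settles the value.\<close>

lemma R0_optimal_step:
  assumes s: "0 < s" "s < 1"
  shows "R0 (1 - s) (s\<^sup>2) = s"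
proof -
  have "(SUP l\<in>{-(s\<^sup>2)..s\<^sup>2}. Max (cmod ` {z. P_quad l (1 - s) z = 0})) \<le> s"
    using P_quad_roots s
    by (intro cSUP_least) (auto simp: Max_le_iff intro!: P_quad_root_bound)
  then show ?thesis using s by (simp add: R0_def)
qed

lemma P_quad_large_real_root:
  assumes s: "0 < s" "s < 1" and \<beta>: "1 - s < \<beta>"
  obtains x where "s < x" "P_quad (s\<^sup>2) \<beta> (complex_of_real x) = 0"
proof -
  define p where "p = [:(s\<^sup>2)\<^sup>2 - \<beta> * s\<^sup>2, - (2 - \<beta>) * s\<^sup>2, 1:]"
  have p: "poly p x = (x - s\<^sup>2)\<^sup>2 + \<beta> * s\<^sup>2 * (x - 1)" for x
    by (simp add: p_def power2_eq_square algebra_simps)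
  have "poly p s = s\<^sup>2 * (1 - s) * (1 - s - \<beta>)"
    by (simp add: p power2_eq_square algebra_simps)
  then have neg: "poly p s < 0"
    using s \<beta> by (simp add: mult_less_0_iff)
  \<comment> \<open>At 1 the term with \<beta> vanishes and (1 - s^2)^2 remains, so the sign changes
    between s and 1 for every \<beta> > 1 - s.\<close>
  have "0 < poly p 1"
    using s by (simp add: p power2_eq_1_iff)
  then obtain x where x: "s < x" "poly p x = 0"
    using poly_IVT_pos[OF s(2) neg] by auto
  have "P_quad (s\<^sup>2) \<beta> (complex_of_real x) = complex_of_real (poly p x)"
    by (simp add: P_quad_def p)
  then show thesis using that x by simp
qed

section \<open>The spectral radius of \<open>A\<^sub>0(\<beta>)\<close> at and away from the optimal
  step\<close>

lemma rho_reduced_system_matrix_0: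
  shows "z = complex_of_real (1 - \<beta>) \<or> (\<exists>k<N - 1. P_quad (ls ! Suc k) \<beta> z = 0) \<Longrightarrow>
      cmod z \<le> rho (reduced_system_matrix_0 N ls \<beta>)"
    and "\<exists>z. (z = complex_of_real (1 - \<beta>) \<or> (\<exists>k<N - 1. P_quad (ls ! Suc k) \<beta> z = 0)) \<and>
      rho (reduced_system_matrix_0 N ls \<beta>) = cmod z"
  using rho_char_poly[OF reduced_system_matrix_0_carrier[of N ls \<beta>]]
  unfolding char_poly_reduced_system_matrix_0_root_iff by auto

text \<open>The root bound gives the upper estimate; the isolated eigenvalue 1 - \<beta> = s attains
  it.\<close>

lemma rho_reduced_system_matrix_0_optimal:
  assumes s: "0 < s" "s < 1" and l: "\<And>k. k < N - 1 \<Longrightarrow> \<bar>ls ! Suc k\<bar> \<le> s\<^sup>2"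
  shows "rho (reduced_system_matrix_0 N ls (1 - s)) = s"
proof (rule antisym)
  obtain z where "z = complex_of_real s \<or> (\<exists>k<N - 1. P_quad (ls ! Suc k) (1 - s) z = 0)"
    and rho: "rho (reduced_system_matrix_0 N ls (1 - s)) = cmod z"
    using rho_reduced_system_matrix_0(2)[of "1 - s" N ls] by auto
  then show "rho (reduced_system_matrix_0 N ls (1 - s)) \<le> s"
    using s P_quad_root_bound[OF s l] by (auto simp: rho)
  show "s \<le> rho (reduced_system_matrix_0 N ls (1 - s))"
    using rho_reduced_system_matrix_0(1)[of "complex_of_real s" "1 - s" N ls] s by simp
qed

text \<open>Since s^2 occurs among the modes, the real root of its quadratic beyond s is an
  eigenvalue when \<beta> is too large; when \<beta> is too small, 1 - \<beta> is the
  obstruction.\<close>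

lemma rho_reduced_system_matrix_0_gt:
  assumes s: "0 < s" "s < 1" and k: "k < N - 1" "ls ! Suc k = s\<^sup>2" and \<beta>: "\<beta> \<noteq> 1 - s"
  shows "s < rho (reduced_system_matrix_0 N ls \<beta>)"
proof (cases "\<beta> < 1 - s")
  case True
  have "cmod (complex_of_real (1 - \<beta>)) \<le> rho (reduced_system_matrix_0 N ls \<beta>)"
    by (rule rho_reduced_system_matrix_0) auto
  then show ?thesis using True by (simp only: norm_of_real)
next
  case False
  with \<beta> have "1 - s < \<beta>" by simp
  then obtain x where x: "s < x" "P_quad (s\<^sup>2) \<beta> (complex_of_real x) = 0"
    using P_quad_large_real_root[OF s] by blast
  then have "cmod (complex_of_real x) \<le> rho (reduced_system_matrix_0 N ls \<beta>)"
    using k by (intro rho_reduced_system_matrix_0) auto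
  then show ?thesis using x by (simp only: norm_of_real)
qed

section \<open>Equal curvatures\<close>

lemma reduced_system_matrix_no_dispersion:
  assumes h: "\<And>i. i < N \<Longrightarrow> 0 < h $ i" and N: "0 < N"
    and \<eta>: "curvature_dispersion N h = 0" and U: "U \<in> carrier_mat N (N - 1)"
  shows "reduced_system_matrix N ls h U \<beta> = reduced_system_matrix_0 N ls \<beta>"
proof -
  have mean: "0 < mean_curvature N h"
    unfolding mean_curvature_def using h N by (intro divide_pos_pos sum_pos) auto
  let ?S = "(\<lambda>i. \<bar>h $ i - mean_curvature N h\<bar>) ` {..<N}"
  \<comment> \<open>Division by zero yields zero, so positivity of the mean is what transfers the
    vanishing of the quotient to its numerator.\<close>
  have "Max ?S = 0" using \<eta> mean by (simp add: curvature_dispersion_def)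
  then have "h $ i = mean_curvature N h" if "i < N" for i
    using Max_ge[of ?S "\<bar>h $ i - mean_curvature N h\<bar>"] that by auto
  then have \<Delta>: "mat_diag N (\<lambda>i. h $ i / mean_curvature N h) - 1\<^sub>m N = 0\<^sub>m N N"
    using mean by (intro eq_matI) (auto simp: mat_diag_def)
  have L: "Lambda_mat N ls \<in> carrier_mat (N - 1) (N - 1)" by (simp add: Lambda_mat_def)
  have UT: "transpose_mat U \<in> carrier_mat (N - 1) N" using U by simp
  have \<delta>: "transpose_mat U * 0\<^sub>m N N * mat N 1 (\<lambda>_. 1 / sqrt (real N)) = 0\<^sub>m (N - 1) 1"
    using UT by simp
  have \<Delta>': "transpose_mat U * 0\<^sub>m N N * U = 0\<^sub>m (N - 1) (N - 1)"
    using UT U by simp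
  have zero: "transpose_mat (0\<^sub>m (N - 1) 1) = (0\<^sub>m 1 (N - 1) :: real mat)" 
    by (intro eq_matI) auto
  have sm: "(1\<^sub>m (N - 1) - \<beta> \<cdot>\<^sub>m 1\<^sub>m (N - 1)) * Lambda_mat N ls = (1 - \<beta>) \<cdot>\<^sub>m Lambda_mat N ls"
  proof -
    have "1\<^sub>m (N - 1) - \<beta> \<cdot>\<^sub>m 1\<^sub>m (N - 1) = (1 - \<beta>) \<cdot>\<^sub>m 1\<^sub>m (N - 1)"
      by (intro eq_matI) auto
    then show ?thesis using L by (simp add: mult_smult_assoc_mat[of _ "N - 1" "N - 1" _ "N - 1"])
  qed
  have LI: "Lambda_mat N ls - 1\<^sub>m (N - 1) \<in> carrier_mat (N - 1) (N - 1)"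
    by (intro minus_carrier_mat) simp
  have z0: "\<beta> \<cdot>\<^sub>m 0\<^sub>m i j = 0\<^sub>m i j" "- (0\<^sub>m i j) = (0\<^sub>m i j :: real mat)" for i j
    by (intro eq_matI; simp)+
  show ?thesis
    unfolding reduced_system_matrix_def reduced_system_matrix_0_def Let_def \<Delta> \<delta> \<Delta>' zero
    using L LI by (simp add: z0 sm del: One_nat_def)
qed

section \<open>The essential spectral radius under the dominance assumption\<close>

text \<open>Dominance makes \<open>\<lambda>\<^sub>2\<close> nonnegative and, as the list is sorted,
  of largest modulus among the eigenvalues left after one copy of 1 is replaced by 0.\<close>

lemma ess_spectral_radius_consensus:
  assumes N: "1 < N" and W: "consensus_matrix N G W" and ls: "eigenvalues_desc W ls"
    and dominant: "ls ! 1 \<ge> \<bar>ls ! (N - 1)\<bar>"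
  shows "ess_spectral_radius N W = ls ! 1"
    and "\<And>k. k < N - 1 \<Longrightarrow> \<bar>ls ! Suc k\<bar> \<le> ls ! 1"
proof -
  have Wc: "W \<in> carrier_mat N N" and ds: "doubly_stochastic N W"
    using W by (auto simp: consensus_matrix_def)
  have cp: "char_poly W = (\<Prod>a\<leftarrow>ls. [:- a, 1:])" and sorted: "sorted_wrt (\<ge>) ls"
    using ls by (auto simp: eigenvalues_desc_def)
  have len: "length ls = N"
    using degree_monic_char_poly[OF Wc] degree_linear_factors[of uminus ls] by (simp add: cp)
  obtain d where d: "char_poly W = [:-1, 1:] * d"
    "char_poly (W - mat N N (\<lambda>_. 1 / real N)) = [:0, 1:] * d"
    using char_poly_sub_averaging[OF Wc] N ds by (auto simp: doubly_stochastic_def)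
  have roots: "poly (char_poly W) x = 0 \<longleftrightarrow> x \<in> set ls" for x
    unfolding cp poly_prod_list by (auto simp: prod_list_zero_iff)
  obtain a ls' where cons: "ls = a # ls'" using len N by (cases ls) auto
  have "1 \<in> set ls" using roots[of 1] by (simp add: d)
  moreover have "a \<le> 1"
    using stochastic_eigenvalue_le_1[OF Wc] ds eigenvalue_root_char_poly[OF Wc] roots cons
    by (auto simp: doubly_stochastic_def)
  \<comment> \<open>The list contains 1 and its largest entry is at most 1. This identifies the
    head, so that x - 1 can be cancelled to express \<open>d\<close> by the tail.\<close>
  ultimately have a: "a = 1" using sorted cons by auto
  have "[:-1, 1:] * d = [:-1, 1:] * (\<Prod>a\<leftarrow>ls'. [:- a, 1:])"
    using d(1) by (simp only: cp cons a list.map prod_list.Cons)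
  then have d': "d = (\<Prod>a\<leftarrow>ls'. [:- a, 1:])"
    by (subst (asm) mult_left_cancel) simp_all
  show bound: "\<bar>ls ! Suc k\<bar> \<le> ls ! 1" if k: "k < N - 1" for k
  proof -
    have "ls ! Suc k \<le> ls ! 1" 
      using sorted k len by (cases k) (auto simp: sorted_wrt_iff_nth_less)
    moreover have "ls ! (N - 1) \<le> ls ! Suc k"
      using sorted k len by (cases "Suc k = N - 1") (auto simp: sorted_wrt_iff_nth_less)
    ultimately show ?thesis using dominant by linarith
  qed
  have carr: "W - mat N N (\<lambda>_. 1 / real N) \<in> carrier_mat N N" by auto
  have root: "poly (map_poly complex_of_real (char_poly (W - mat N N (\<lambda>_. 1 / real N)))) z = 0 \<longleftrightarrow>
      z = 0 \<or> (\<exists>k<N - 1. z = complex_of_real (ls ! Suc k))" for z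
  proof -
    interpret map_poly_hom: map_poly_comm_ring_hom complex_of_real ..
    have "poly (map_poly complex_of_real d) z = (\<Prod>a\<leftarrow>ls'. z - complex_of_real a)"
      unfolding d' by (induction ls') (simp_all only: list.map prod_list.Cons prod_list.Nil map_poly_hom.hom_mult poly_mult, simp_all)
    then have "poly (map_poly complex_of_real d) z = 0 \<longleftrightarrow> (\<exists>a\<in>set ls'. z = complex_of_real a)"
      by (auto simp: prod_list_zero_iff)
    then show ?thesis
      using len cons unfolding d(2) map_poly_hom.hom_mult poly_mult mult_eq_0_iff
      by (auto simp: in_set_conv_nth)
  qed
  note rho = rho_char_poly[OF carr, unfolded root]
  show "ess_spectral_radius N W = ls ! 1"
    unfolding ess_spectral_radius_def
  proof (rule antisym)
    obtain z where "z = 0 \<or> (\<exists>k<N - 1. z = complex_of_real (ls ! Suc k))"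
      "rho (W - mat N N (\<lambda>_. 1 / real N)) = cmod z"
      using rho(2) N by auto
    \<comment> \<open>The root 0 is covered too, because \<open>dominant\<close> gives
      \<open>0 \<le> ls ! 1\<close>.\<close>
    then show "rho (W - mat N N (\<lambda>_. 1 / real N)) \<le> ls ! 1"
      using bound dominant by auto
    have "cmod (complex_of_real (ls ! Suc 0)) \<le> rho (W - mat N N (\<lambda>_. 1 / real N))"
      using N by (intro rho(1) disjI2 exI[of _ 0]) auto
    then show "ls ! 1 \<le> rho (W - mat N N (\<lambda>_. 1 / real N))" by simp
  qed
qed

text \<open>Ensures that \<open>\<lambda>\<^sub>2\<close> exists: a connected graph has a vertex,
  and with a single agent the row sum would force the diagonal weight to be 1, although it is below
  1.\<close>

lemma consensus_matrix_size:
  assumes graph: "connected_graph_on N G" and W: "consensus_matrix N G W"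
  shows "1 < N"
proof (rule ccontr)
  assume "\<not> 1 < N"
  moreover have "N \<noteq> 0"
    using graph by (auto simp: connected_graph_on_def connected_def strongly_connected_def)
  ultimately have "N = 1" by simp
  then have "W $$ (0, 0) < 1" "W $$ (0, 0) = 1"
    using W by (auto simp: consensus_matrix_def doubly_stochastic_def)
  then show False by simp
qed

section \<open>The optimal step size\<close>

theorem lemma2:
  fixes N :: nat and G :: "nat pair_pre_digraph" and W :: "real mat"
    and ls :: "real list" and h :: "real vec" and \<sigma> :: real
  assumes graph: "connected_graph_on N G"
    and W: "consensus_matrix N G W"
    and ls: "eigenvalues_desc W ls"
    and h: "h \<in> carrier_vec N" "\<And>i. i < N \<Longrightarrow> 0 < h $ i"
    and \<sigma>: "\<sigma> = ess_spectral_radius N W" "0 < \<sigma>" "\<sigma> < 1"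
    and \<eta>: "curvature_dispersion N h = 0"
    and dominant: "ls ! 1 \<ge> \<bar>ls ! (N - 1)\<bar>"
  shows "(\<forall>U \<beta>. orthonormal_eigenbasis N W ls U \<longrightarrow>
            reduced_system_matrix N ls h U \<beta> = reduced_system_matrix_0 N ls \<beta>) \<and>
         {\<beta>. is_arg_min (\<lambda>\<beta>. rho (reduced_system_matrix_0 N ls \<beta>)) (\<lambda>\<beta>. 0 < \<beta>) \<beta>}
            = {1 - sqrt \<sigma>} \<and>
         rho (reduced_system_matrix_0 N ls (1 - sqrt \<sigma>)) = R0 (1 - sqrt \<sigma>) \<sigma> \<and>
         R0 (1 - sqrt \<sigma>) \<sigma> = sqrt \<sigma>"
proof -
  have N: "1 < N" using consensus_matrix_size[OF graph W] .
  define s where "s = sqrt \<sigma>"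
  have s: "0 < s" "s < 1" and s2: "s\<^sup>2 = \<sigma>" using \<sigma> by (auto simp: s_def)
  note ess = ess_spectral_radius_consensus[OF N W ls dominant]
  have at: "rho (reduced_system_matrix_0 N ls (1 - s)) = s"
    using ess s by (intro rho_reduced_system_matrix_0_optimal) (auto simp: s2 \<sigma>(1))
  \<comment> \<open>Index 0 selects \<open>ls ! Suc 0\<close>, that is
    \<open>\<lambda>\<^sub>2\<close> = \<sigma> = s^2.\<close>
  have gt: "s < rho (reduced_system_matrix_0 N ls \<beta>)" if "\<beta> \<noteq> 1 - s" for \<beta>
    using ess N s that by (intro rho_reduced_system_matrix_0_gt[of _ 0]) (auto simp: s2 \<sigma>(1))
  \<comment> \<open>The point 1 - s is admissible because s < 1; the strict bound \<open>gt\<close>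
    gives both minimality and uniqueness.\<close>
  have "is_arg_min (\<lambda>\<beta>. rho (reduced_system_matrix_0 N ls \<beta>)) (\<lambda>\<beta>. 0 < \<beta>) \<beta> \<longleftrightarrow> \<beta> = 1 - s" for \<beta>
    using at gt[of \<beta>] gt s unfolding is_arg_min_def
    by (metis diff_gt_0_iff_gt less_asym less_irrefl)
  then have "{\<beta>. is_arg_min (\<lambda>\<beta>. rho (reduced_system_matrix_0 N ls \<beta>)) (\<lambda>\<beta>. 0 < \<beta>) \<beta>} = {1 - s}"
    by simp
  moreover have "R0 (1 - s) \<sigma> = s" using R0_optimal_step[OF s] by (simp add: s2)
  moreover have "\<forall>U \<beta>. orthonormal_eigenbasis N W ls U \<longrightarrow>
      reduced_system_matrix N ls h U \<beta> = reduced_system_matrix_0 N ls \<beta>"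
    using reduced_system_matrix_no_dispersion[OF h(2) _ \<eta>] N
    by (auto simp: orthonormal_eigenbasis_def)
  ultimately show ?thesis using at by (simp flip: s_def)
qed

end
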